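(* Let $d\ge 2$ be an integer and $q$ a prime power. 1) Any Nikodym set in $\mathbb{F}_q^d$ is a weak Nikodym set. The converse does not hold in general: there exist $d$, $q$ and a weak Nikodym set in $\mathbb{F}_q^d$ that is not a Nikodym set. 2) A set $N\subset\mathbb{F}_q^d$ is a weak Nikodym set if and only if its complement $\mathbb{F}_q^d\setminus N$ is contained in the point set of an induced matching in the point-line incidence graph of $\mathbb{F}_q^d$. 3) If a set $N\subset\mathbb{F}_q^d$ is a weak Nikodym set, then the set $N\times\mathbb{F}_q\subset\mathbb{F}_q^{d+1}$ is a Nikodym set.
   Context: For $x\in\mathbb{F}_q^d$ and $v\in\mathbb{F}_q^d\setminus\{0\}$ write $\ell(x,v)=\{x+tv: t\in\mathbb{F}_q\}$ and $\ell(x,v)^*=\ell(x,v)\setminus\{x\}$. A set $N\subset\mathbb{F}_q^d$ is a Nikodym set if for every $x\in\mathbb{F}_q^d$ there exists $v\in\mathbb{F}_q^d\setminus\{0\}$ with $\ell(x,v)^*\subset N$. It is a weak Nikodym set if for every $x\in\mathbb{F}_q^d\setminus N$ there exists $v\in\mathbb{F}_q^d\setminus\{0\}$ with $\ell(x,v)^*\subset N$. An induced matching in the point-line incidence graph of $\mathbb{F}_q^d$ is a collection of pairs $(p_1,\ell_1),\dots,(p_m,\ell_m)$, with $p_i\in\mathbb{F}_q^d$ and $\ell_j$ affine lines in $\mathbb{F}_q^d$, such that $p_i\in\ell_j$ if and only if $i=j$; its point set is $\{p_1,\dots,p_m\}$. *)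

theory Defs
  imports "HOL-Algebra.Ring" "HOL-Number_Theory.Prime_Powers"
begin

text \<open>
  A field with \<open>q\<close> elements is an explicit ring structure with a carrier, so that statements can
  also assert the existence of a finite field.
\<close>

definition finite_field_of_order :: "('a, 'b) ring_scheme \<Rightarrow> nat \<Rightarrow> bool" where
  "finite_field_of_order F q \<longleftrightarrow> field F \<and> finite (carrier F) \<and> card (carrier F) = q"

text \<open>
  A vector of \<open>F\<^sup>d\<close> is a function on \<open>{..<d}\<close>, extended by \<open>undefined\<close> outside of
  \<open>{..<d}\<close>, so that equality of vectors is equality of their \<open>d\<close> coordinates.
\<close>

definition vecs :: "('a, 'b) ring_scheme \<Rightarrow> nat \<Rightarrow> (nat \<Rightarrow> 'a) set" where
  "vecs F d = {..<d} \<rightarrow>\<^sub>E carrier F"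

definition zero_vec :: "('a, 'b) ring_scheme \<Rightarrow> nat \<Rightarrow> nat \<Rightarrow> 'a" where
  "zero_vec F d = (\<lambda>i\<in>{..<d}. \<zero>\<^bsub>F\<^esub>)"

definition line :: "('a, 'b) ring_scheme \<Rightarrow> nat \<Rightarrow> (nat \<Rightarrow> 'a) \<Rightarrow> (nat \<Rightarrow> 'a) \<Rightarrow> (nat \<Rightarrow> 'a) set" where
  "line F d x v = {(\<lambda>i\<in>{..<d}. x i \<oplus>\<^bsub>F\<^esub> t \<otimes>\<^bsub>F\<^esub> v i) | t. t \<in> carrier F}"

definition punctured_line ::
    "('a, 'b) ring_scheme \<Rightarrow> nat \<Rightarrow> (nat \<Rightarrow> 'a) \<Rightarrow> (nat \<Rightarrow> 'a) \<Rightarrow> (nat \<Rightarrow> 'a) set" where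
  "punctured_line F d x v = line F d x v - {x}"

definition lines :: "('a, 'b) ring_scheme \<Rightarrow> nat \<Rightarrow> (nat \<Rightarrow> 'a) set set" where
  "lines F d = {line F d x v | x v. x \<in> vecs F d \<and> v \<in> vecs F d - {zero_vec F d}}"

definition nikodym :: "('a, 'b) ring_scheme \<Rightarrow> nat \<Rightarrow> (nat \<Rightarrow> 'a) set \<Rightarrow> bool" where
  "nikodym F d N \<longleftrightarrow> N \<subseteq> vecs F d \<and>
     (\<forall>x \<in> vecs F d. \<exists>v \<in> vecs F d - {zero_vec F d}. punctured_line F d x v \<subseteq> N)"

definition weak_nikodym :: "('a, 'b) ring_scheme \<Rightarrow> nat \<Rightarrow> (nat \<Rightarrow> 'a) set \<Rightarrow> bool" where
  "weak_nikodym F d N \<longleftrightarrow> N \<subseteq> vecs F d \<and>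
     (\<forall>x \<in> vecs F d - N. \<exists>v \<in> vecs F d - {zero_vec F d}. punctured_line F d x v \<subseteq> N)"

text \<open>The collection of pairs \<open>(p\<^sub>1, \<ell>\<^sub>1), \<dots>, (p\<^sub>m, \<ell>\<^sub>m)\<close> is a list.\<close>

definition induced_matching ::
    "('a, 'b) ring_scheme \<Rightarrow> nat \<Rightarrow> ((nat \<Rightarrow> 'a) \<times> (nat \<Rightarrow> 'a) set) list \<Rightarrow> bool" where
  "induced_matching F d M \<longleftrightarrow> set M \<subseteq> vecs F d \<times> lines F d \<and>
     (\<forall>i < length M. \<forall>j < length M. fst (M ! i) \<in> snd (M ! j) \<longleftrightarrow> i = j)"

definition point_set :: "((nat \<Rightarrow> 'a) \<times> (nat \<Rightarrow> 'a) set) list \<Rightarrow> (nat \<Rightarrow> 'a) set" where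
  "point_set M = fst ` set M"

text \<open>
  The set \<open>N \<times> F\<close> as a subset of \<open>F\<^sup>d\<^sup>+\<^sup>1\<close>: the element of \<open>F\<close> becomes the new last coordinate,
  which has index \<open>d\<close>.
\<close>

definition times_field ::
    "('a, 'b) ring_scheme \<Rightarrow> nat \<Rightarrow> (nat \<Rightarrow> 'a) set \<Rightarrow> (nat \<Rightarrow> 'a) set" where
  "times_field F d N = {x(d := t) | x t. x \<in> N \<and> t \<in> carrier F}"

end

theory Submission
  imports Defs
begin

text \<open>
  For the failure of the converse take \<open>q = d = 2\<close>: a punctured line is a single point, so a
  singleton is a weak Nikodym set, but it contains no punctured line centred at its own point.
  For the characterization, attach to each \<open>x \<notin> N\<close> the line through \<open>x\<close> whose other points lie
  in \<open>N\<close>. For the product, use a horizontal line over a point outside \<open>N\<close>, and the vertical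
  line over a point of \<open>N\<close>.
\<close>

section \<open>Points and lines of the affine space over a field\<close>

lemma finite_vecs: "finite (carrier F) \<Longrightarrow> finite (vecs F d)"
  unfolding vecs_def by (intro finite_PiE) auto

context field
begin

lemma line_subset_vecs:
  assumes "x \<in> vecs R d" "v \<in> vecs R d"
  shows "line R d x v \<subseteq> vecs R d"
  using assms unfolding line_def vecs_def by (auto simp: PiE_iff split: if_splits)

lemma in_line:
  assumes "x \<in> vecs R d" "v \<in> vecs R d"
  shows "x \<in> line R d x v"
proof -
  have "x = (\<lambda>i\<in>{..<d}. x i \<oplus> \<zero> \<otimes> v i)"
    using assms unfolding vecs_def by (auto simp: PiE_iff extensional_def restrict_def fun_eq_iff)
  then show ?thesis unfolding line_def by blast
qed

text \<open>Parameters add: if \<open>x\<close> has parameter \<open>s\<close> seen from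
  \<open>y\<close>, a point with parameter \<open>t\<close> seen from \<open>x\<close> has parameter
  \<open>s \<oplus> t\<close> seen from \<open>y\<close>. This lets a matching line, given with an
  arbitrary base point, be treated as a line through its matched point.\<close>

lemma line_recentre:
  assumes "y \<in> vecs R d" "v \<in> vecs R d" "x \<in> line R d y v"
  shows "line R d x v \<subseteq> line R d y v"
proof
  fix z assume "z \<in> line R d x v"
  then obtain t where t: "t \<in> carrier R" "z = (\<lambda>i\<in>{..<d}. x i \<oplus> t \<otimes> v i)"
    unfolding line_def by blast
  obtain s where s: "s \<in> carrier R" "x = (\<lambda>i\<in>{..<d}. y i \<oplus> s \<otimes> v i)"
    using assms(3) unfolding line_def by blast
  have "z = (\<lambda>i\<in>{..<d}. y i \<oplus> (s \<oplus> t) \<otimes> v i)"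
    unfolding t(2) s(2) using assms(1,2) s(1) t(1)
    by (intro restrict_ext) (auto simp: vecs_def PiE_iff l_distr a_assoc)
  then show "z \<in> line R d y v" using s t unfolding line_def by blast
qed

section \<open>Weak Nikodym sets and induced matchings\<close>

lemma weak_nikodym_imp_matching:
  assumes fin: "finite (carrier R)" and N: "weak_nikodym R d N"
  shows "\<exists>M. induced_matching R d M \<and> vecs R d - N \<subseteq> point_set M"
proof -
  obtain v where v: "\<And>x. x \<in> vecs R d - N \<Longrightarrow> v x \<in> vecs R d - {zero_vec R d}"
      "\<And>x. x \<in> vecs R d - N \<Longrightarrow> punctured_line R d x (v x) \<subseteq> N"
    using N unfolding weak_nikodym_def by metis
  \<comment> \<open>Repetitions are excluded because two indices carrying the same pair would
    violate the incidence condition \<open>i = j\<close>.\<close>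
  obtain xs where xs: "set xs = vecs R d - N" "distinct xs"
    using finite_distinct_list finite_vecs[OF fin] by (metis finite_Diff)
  let ?M = "map (\<lambda>x. (x, line R d x (v x))) xs"
  have "(xs ! i \<in> line R d (xs ! j) (v (xs ! j))) \<longleftrightarrow> i = j"
    if "i < length xs" "j < length xs" for i j
  proof -
    have ij: "xs ! i \<in> vecs R d - N" "xs ! j \<in> vecs R d - N" using that xs(1) nth_mem by blast+
    \<comment> \<open>Apart from its centre \<open>xs ! j\<close>, the line lies in
      \<open>N\<close>, whereas \<open>xs ! i\<close> lies outside \<open>N\<close>.\<close>
    have "xs ! i \<in> line R d (xs ! j) (v (xs ! j)) \<longleftrightarrow> xs ! i = xs ! j"
      using v(2)[OF ij(2)] ij in_line[of "xs ! j" d "v (xs ! j)"] v(1)[OF ij(2)]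
      unfolding punctured_line_def by auto
    then show ?thesis using that xs(2) by (simp add: nth_eq_iff_index_eq)
  qed
  moreover have "set ?M \<subseteq> vecs R d \<times> lines R d"
    using xs(1) v(1) unfolding lines_def by auto
  ultimately have "induced_matching R d ?M" unfolding induced_matching_def by simp
  moreover have "vecs R d - N \<subseteq> point_set ?M"
    using xs(1) unfolding point_set_def by force
  ultimately show ?thesis by blast
qed

text \<open>The line matched with \<open>x\<close> passes through no other matched point. Since
  every point outside \<open>N\<close> is matched, the rest of that line lies in \<open>N\<close>,
  so its direction serves for \<open>x\<close>.\<close>

lemma matching_imp_weak_nikodym:
  assumes N: "N \<subseteq> vecs R d" and M: "induced_matching R d M" "vecs R d - N \<subseteq> point_set M"
  shows "weak_nikodym R d N"
  unfolding weak_nikodym_def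
proof (intro conjI ballI N)
  have index: "\<exists>i < length M. z = fst (M ! i)" if "z \<in> vecs R d - N" for z
  proof -
    have "z \<in> fst ` set M" using that M(2) unfolding point_set_def by blast
    then show ?thesis unfolding image_iff by (metis in_set_conv_nth)
  qed
  fix x assume x: "x \<in> vecs R d - N"
  then obtain i where i: "i < length M" "x = fst (M ! i)" using index by blast
  have "M ! i \<in> vecs R d \<times> lines R d"
    using M(1) i(1) nth_mem unfolding induced_matching_def by blast
  then obtain y v where yv: "snd (M ! i) = line R d y v" "y \<in> vecs R d"
      "v \<in> vecs R d - {zero_vec R d}"
    unfolding lines_def mem_Times_iff by blast
  have "x \<in> line R d y v"
    using M(1) i unfolding induced_matching_def yv(1)[symmetric] by blast
  then have sub: "line R d x v \<subseteq> snd (M ! i)" using line_recentre yv by auto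
  have "punctured_line R d x v \<subseteq> N"
  proof
    fix z assume z: "z \<in> punctured_line R d x v"
    then have zl: "z \<in> line R d x v" "z \<noteq> x" unfolding punctured_line_def by auto
    then have "z \<in> vecs R d" using line_subset_vecs x yv(3) by blast
    moreover have False if zN: "z \<in> vecs R d - N"
    proof -
      \<comment> \<open>Being outside \<open>N\<close>, \<open>z\<close> is itself a matched point;
        lying on the \<open>i\<close>-th line it must have index \<open>j = i\<close>, hence equal
        \<open>x\<close>.\<close>
      obtain j where "j < length M" "z = fst (M ! j)" using index[OF zN] by blast
      then show False
        using M(1) i zl sub unfolding induced_matching_def by blast
    qed
    ultimately show "z \<in> N" by blast
  qed
  then show "\<exists>v \<in> vecs R d - {zero_vec R d}. punctured_line R d x v \<subseteq> N" using yv(3) by blast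
qed

section \<open>The product with the field\<close>

lemma restrict_vecs_Suc: "x \<in> vecs R (Suc d) \<Longrightarrow> restrict x {..<d} \<in> vecs R d"
  unfolding vecs_def by (auto simp: PiE_iff)

lemma fun_upd_vecs_Suc: "x \<in> vecs R d \<Longrightarrow> t \<in> carrier R \<Longrightarrow> x(d := t) \<in> vecs R (Suc d)"
  unfolding vecs_def by (auto simp: PiE_iff extensional_def less_Suc_eq)

text \<open>Reduces membership in the product to the projection onto the first \<open>d\<close>
  coordinates; the last coordinate of \<open>z\<close> supplies the field element.\<close>

lemma mem_times_field:
  assumes "z \<in> vecs R (Suc d)" "restrict z {..<d} \<in> N"
  shows "z \<in> times_field R d N"
proof -
  have "z = (restrict z {..<d})(d := z d)"
    using assms(1) by (auto simp: vecs_def PiE_iff extensional_def fun_eq_iff less_Suc_eq)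
  moreover have "z d \<in> carrier R" using assms(1) by (auto simp: vecs_def)
  ultimately show ?thesis using assms(2) unfolding times_field_def by blast
qed

lemma restrict_line_point:
  "restrict (\<lambda>i\<in>{..<Suc d}. x i \<oplus> t \<otimes> v i) {..<d} = (\<lambda>i\<in>{..<d}. x i \<oplus> t \<otimes> v i)"
  by (auto simp: restrict_def fun_eq_iff)

lemma nikodym_times_field:
  assumes N: "weak_nikodym R d N"
  shows "nikodym R (Suc d) (times_field R d N)"
  unfolding nikodym_def
proof (intro conjI ballI)
  show "times_field R d N \<subseteq> vecs R (Suc d)"
    using N fun_upd_vecs_Suc unfolding weak_nikodym_def times_field_def by auto
  fix x assume x: "x \<in> vecs R (Suc d)"
  let ?x = "restrict x {..<d}"
  show "\<exists>v \<in> vecs R (Suc d) - {zero_vec R (Suc d)}.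
      punctured_line R (Suc d) x v \<subseteq> times_field R d N"
  proof (cases "?x \<in> N")
    case True
    \<comment> \<open>The last unit vector: moving along it keeps the first \<open>d\<close>
      coordinates, so the entire line lies over \<open>?x\<close>.\<close>
    let ?v = "(zero_vec R d)(d := \<one>)"
    have v: "?v \<in> vecs R (Suc d)"
      by (rule fun_upd_vecs_Suc) (auto simp: vecs_def zero_vec_def)
    have "?v d \<noteq> zero_vec R (Suc d) d" by (simp add: zero_vec_def)
    then have "?v \<noteq> zero_vec R (Suc d)" by metis
    moreover have "punctured_line R (Suc d) x ?v \<subseteq> times_field R d N"
    proof
      fix z assume "z \<in> punctured_line R (Suc d) x ?v"
      then have zl: "z \<in> line R (Suc d) x ?v" by (simp add: punctured_line_def)
      then obtain t where t: "t \<in> carrier R" "z = (\<lambda>i\<in>{..<Suc d}. x i \<oplus> t \<otimes> ?v i)"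
        unfolding line_def by blast
      have "restrict z {..<d} = ?x"
        unfolding t(2) restrict_line_point using t(1) x
        by (intro restrict_ext) (auto simp: zero_vec_def vecs_def PiE_iff)
      then show "z \<in> times_field R d N"
        using True mem_times_field line_subset_vecs[OF x v] zl by auto
    qed
    ultimately show ?thesis using v by blast
  next
    case False
    then obtain w where w: "w \<in> vecs R d" "w \<noteq> zero_vec R d" "punctured_line R d ?x w \<subseteq> N"
      using N restrict_vecs_Suc[OF x] unfolding weak_nikodym_def by blast
    \<comment> \<open>With last coordinate zero, the line through \<open>x\<close> projects to the
      line through \<open>?x\<close> with direction \<open>w\<close>, at constant height.\<close>
    let ?v = "w(d := \<zero>)"
    have v: "?v \<in> vecs R (Suc d)" using w(1) fun_upd_vecs_Suc by auto
    have "restrict ?v {..<d} = w"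
      using w(1) by (auto simp: vecs_def PiE_iff extensional_def fun_eq_iff restrict_def)
    moreover have "restrict (zero_vec R (Suc d)) {..<d} = zero_vec R d"
      by (auto simp: zero_vec_def restrict_def fun_eq_iff)
    ultimately have "?v \<noteq> zero_vec R (Suc d)" using w(2) by metis
    moreover have "punctured_line R (Suc d) x ?v \<subseteq> times_field R d N"
    proof
      fix z assume "z \<in> punctured_line R (Suc d) x ?v"
      then have zl: "z \<in> line R (Suc d) x ?v" "z \<noteq> x" by (auto simp: punctured_line_def)
      then obtain t where t: "t \<in> carrier R" "z = (\<lambda>i\<in>{..<Suc d}. x i \<oplus> t \<otimes> ?v i)"
        unfolding line_def by blast
      have zv: "z \<in> vecs R (Suc d)" using line_subset_vecs[OF x v] zl by auto
      have zr: "restrict z {..<d} = (\<lambda>i\<in>{..<d}. ?x i \<oplus> t \<otimes> w i)"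
        unfolding t(2) restrict_line_point by (intro restrict_ext) auto
      have zd: "z d = x d" using t x by (auto simp: vecs_def PiE_iff)
      \<comment> \<open>Constant height makes the projection injective on this line, so removing
        \<open>x\<close> above corresponds to removing \<open>?x\<close> below.\<close>
      have "restrict z {..<d} \<noteq> ?x"
      proof
        assume eq: "restrict z {..<d} = ?x"
        have "z i = x i" if "i \<in> {..<Suc d}" for i
          using that zd fun_cong[OF eq, of i] by (cases "i = d") auto
        then have "z = x" using zv x unfolding vecs_def by (blast intro: PiE_ext)
        with zl(2) show False by blast
      qed
      then have "restrict z {..<d} \<in> punctured_line R d ?x w"
        using zr t(1) unfolding punctured_line_def line_def by blast
      then show "z \<in> times_field R d N" using w(3) zv mem_times_field by blast
    qed
    ultimately show ?thesis using v by blast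
  qed
qed

end

section \<open>The counterexample over the field with two elements\<close>

definition binary_field :: "nat ring" where
  "binary_field = \<lparr>carrier = {0, 1}, monoid.mult = (*), one = 1, zero = 0,
     add = (\<lambda>x y. (x + y) mod 2)\<rparr>"

lemma binary_field_simps [simp]:
  "carrier binary_field = {0, 1}" "x \<otimes>\<^bsub>binary_field\<^esub> y = x * y" "\<one>\<^bsub>binary_field\<^esub> = 1"
  "\<zero>\<^bsub>binary_field\<^esub> = 0" "x \<oplus>\<^bsub>binary_field\<^esub> y = (x + y) mod 2"
  by (simp_all add: binary_field_def)

lemma field_binary_field: "field binary_field"
proof -
  have "cring binary_field"
  proof (rule cringI)
    show "abelian_group binary_field" by (rule abelian_groupI) auto
    show "comm_monoid binary_field" by (rule comm_monoidI) auto
  qed auto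
  then show ?thesis by (rule cring.cring_fieldI2) auto
qed

text \<open>A nonzero \<open>x\<close> serves as its own direction: in characteristic 2 the line
  through \<open>x\<close> along \<open>x\<close> consists of \<open>x\<close> and
  \<open>x + x\<close>, the origin.\<close>

lemma weak_nikodym_binary_zero: "weak_nikodym binary_field d {zero_vec binary_field d}"
  unfolding weak_nikodym_def
proof (intro conjI ballI)
  let ?F = binary_field and ?o = "zero_vec binary_field d"
  show "{?o} \<subseteq> vecs ?F d" by (auto simp: zero_vec_def vecs_def)
  fix x assume x: "x \<in> vecs ?F d - {?o}"
  then have coord: "x i = 0 \<or> x i = 1" if "i < d" for i
    using that by (auto simp: vecs_def PiE_iff)
  have "z = ?o" if z: "z \<in> line ?F d x x" "z \<noteq> x" for z
  proof -
    obtain t where t: "t = 0 \<or> t = 1" "z = (\<lambda>i\<in>{..<d}. (x i + t * x i) mod 2)"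
      using z(1) by (auto simp: line_def)
    have "t \<noteq> 0"
    proof
      assume "t = 0"
      then have "z = restrict x {..<d}" unfolding t(2) using coord by (intro restrict_ext) force
      with x z(2) show False by (simp add: vecs_def PiE_iff extensional_restrict)
    qed
    \<comment> \<open>What remains is \<open>t = 1\<close>, where each coordinate
      \<open>x i + x i\<close> is even.\<close>
    then show ?thesis using t by (auto simp: zero_vec_def)
  qed
  then have "punctured_line ?F d x x \<subseteq> {?o}" unfolding punctured_line_def by blast
  with x show "\<exists>v \<in> vecs ?F d - {?o}. punctured_line ?F d x v \<subseteq> {?o}" by blast
qed

text \<open>Parameter 1 puts the direction \<open>v\<close> itself on the line through the origin,
  and \<open>v\<close> is nonzero, so the punctured line leaves the singleton.\<close>

lemma not_nikodym_binary_zero: "\<not> nikodym binary_field d {zero_vec binary_field d}"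
proof
  let ?F = binary_field and ?o = "zero_vec binary_field d"
  assume "nikodym ?F d {?o}"
  moreover have "?o \<in> vecs ?F d" by (auto simp: zero_vec_def vecs_def)
  ultimately obtain v where v: "v \<in> vecs ?F d" "v \<noteq> ?o" "punctured_line ?F d ?o v \<subseteq> {?o}"
    unfolding nikodym_def by blast
  have "v = restrict v {..<d}" using v(1) by (simp add: vecs_def PiE_iff extensional_restrict)
  also have "\<dots> = (\<lambda>i\<in>{..<d}. ?o i \<oplus>\<^bsub>?F\<^esub> 1 \<otimes>\<^bsub>?F\<^esub> v i)"
    using v(1) by (intro restrict_ext) (force simp: zero_vec_def vecs_def PiE_iff)
  finally have "v = (\<lambda>i\<in>{..<d}. ?o i \<oplus>\<^bsub>?F\<^esub> 1 \<otimes>\<^bsub>?F\<^esub> v i)" .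
  moreover have "1 \<in> carrier ?F" by simp
  ultimately have "v \<in> line ?F d ?o v" unfolding line_def by blast
  with v(2,3) show False unfolding punctured_line_def by blast
qed

theorem proposition1p5:
  fixes F :: "('a, 'b) ring_scheme" and d q :: nat
  assumes "d \<ge> 2" and "primepow q" and "finite_field_of_order F q"
  shows
    "((\<forall>N. nikodym F d N \<longrightarrow> weak_nikodym F d N) \<and>
      (\<exists>d' q' (G :: nat ring) N. d' \<ge> 2 \<and> primepow q' \<and> finite_field_of_order G q' \<and>
         weak_nikodym G d' N \<and> \<not> nikodym G d' N)) \<and>
     (\<forall>N. N \<subseteq> vecs F d \<longrightarrow>
        (weak_nikodym F d N \<longleftrightarrow>
         (\<exists>M. induced_matching F d M \<and> vecs F d - N \<subseteq> point_set M))) \<and>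
     (\<forall>N. N \<subseteq> vecs F d \<longrightarrow> weak_nikodym F d N \<longrightarrow> nikodym F (d + 1) (times_field F d N))"
proof -
  interpret field F using assms(3) by (simp add: finite_field_of_order_def)
  have fin: "finite (carrier F)" using assms(3) by (simp add: finite_field_of_order_def)
  have 1: "\<forall>N. nikodym F d N \<longrightarrow> weak_nikodym F d N"
    unfolding nikodym_def weak_nikodym_def by blast
  have 2: "\<exists>d' q' (G :: nat ring) N. d' \<ge> 2 \<and> primepow q' \<and> finite_field_of_order G q' \<and>
      weak_nikodym G d' N \<and> \<not> nikodym G d' N"
  proof (intro exI conjI)
    show "(2::nat) \<le> 2" by simp
    show "primepow (2::nat)" by (simp add: primepow_prime)
    show "finite_field_of_order binary_field 2"
      by (simp add: finite_field_of_order_def field_binary_field)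
  \<comment> \<open>These facts fix the last witness, the singleton of the origin in the
    plane.\<close>
  qed (rule weak_nikodym_binary_zero not_nikodym_binary_zero)+
  have 3: "weak_nikodym F d N \<longleftrightarrow>
      (\<exists>M. induced_matching F d M \<and> vecs F d - N \<subseteq> point_set M)" if "N \<subseteq> vecs F d" for N
    using weak_nikodym_imp_matching[OF fin] matching_imp_weak_nikodym[OF that] by blast
  have 4: "nikodym F (d + 1) (times_field F d N)" if "weak_nikodym F d N" for N
    using nikodym_times_field[OF that] by simp
  show ?thesis by (intro conjI allI impI 1 2 3 4)
qed

end
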